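(* Let $\alpha$ be a finitely generated ($2$-fold) tensor norm and let $Y$ be a subspace of a Banach space $X$. If $Y$ is locally $\alpha$-complemented in $X$, then every $\alpha^*$-integral bilinear form on $Y$ separately extends to $X$; that is: (1) every $\alpha^*$-integral bilinear form on $Y\times Y$ extends to an $\alpha^*$-integral bilinear form on $Y\times X$; and (2) every $\alpha^*$-integral bilinear form on $Y\times X$ extends to an $\alpha^*$-integral bilinear form on $X\times X$.
   Context: A tensor norm $\alpha$ assigns to every pair of normed spaces $E_1,E_2$ a norm on $E_1\otimes E_2$ (the resulting space is $E_1\otimes_\alpha E_2$) such that $\varepsilon\le\alpha\le\pi$ (injective and projective norms) and $\|T_1\otimes T_2:E_1\otimes_\alpha E_2\to G_1\otimes_\alpha G_2\|\le\|T_1\|\|T_2\|$ for bounded operators $T_i:E_i\to G_i$. It is finitely generated if the norm of $z$ in $E_1\otimes_\alpha E_2$ equals the infimum of its norms in $M_1\otimes_\alpha M_2$ over finite-dimensional subspaces $M_i\subseteq E_i$ with $z\in M_1\otimes M_2$. A bilinear form $\varphi$ on $E_1\times E_2$ is $\alpha^*$-integral if its linearization belongs to $(E_1\otimes_\alpha E_2)^*$; its norm there is $\|\varphi\|_{\alpha^*}$. For a finite-dimensional $F$, an operator $T:E\to F^*$ is identified with the bilinear form $(e,f)\mapsto T(e)(f)$ on $E\times F$, and $\|T\|_{\mathcal A}$ denotes the norm of this form in $(E\otimes_\alpha F)^*$. $Y$ is locally $\alpha$-complemented in $X$ (through the inclusion $j:Y\hookrightarrow X$) if there is a constant $\lambda$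 such that for every finite-dimensional subspace $F\subseteq X$, every operator $T:Y\to F^*$ can be extended to an operator $\widetilde T:X\to F^*$ with $\|\widetilde T\|_{\mathcal A}\le\lambda\|T\|_{\mathcal A}$.
   Formalization: Part (1) fails for non-symmetric tensor norms; the extension to Y×X is proved if Y is also locally complemented for the transposed norm (automatic when α is symmetric), and without that the extension to X×Y is proved. Scalars are real. *)

theory Defs
  imports "HOL-Analysis.Analysis"
begin

text \<open>
  A normed space is a linear subspace \<open>carr E\<close> of a real vector space type together with a function
  \<open>nrm E\<close> that is a norm on \<open>carr E\<close> (its values elsewhere are irrelevant). The ambient type \<open>'a\<close>
  acts only as a universe; it carries no norm of its own and is a type variable throughout, so that
  ``every pair of normed spaces'' becomes ``every pair of normed spaces with carriers in the
  (arbitrary) universe \<open>'a\<close>''.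
\<close>

section \<open>Normed spaces and operators\<close>

datatype 'a nspace = NSpace (carr: "'a set") (nrm: "'a \<Rightarrow> real")

definition normed_space :: "'a::real_vector nspace \<Rightarrow> bool" where
  "normed_space E \<longleftrightarrow> subspace (carr E)
     \<and> (\<forall>x\<in>carr E. 0 \<le> nrm E x \<and> (nrm E x = 0 \<longleftrightarrow> x = 0))
     \<and> (\<forall>c. \<forall>x\<in>carr E. nrm E (c *\<^sub>R x) = \<bar>c\<bar> * nrm E x)
     \<and> (\<forall>x\<in>carr E. \<forall>y\<in>carr E. nrm E (x + y) \<le> nrm E x + nrm E y)"

definition banach_space :: "'a::real_vector nspace \<Rightarrow> bool" where
  "banach_space E \<longleftrightarrow> normed_space E \<and> Metric_space.mcomplete (carr E) (\<lambda>x y. nrm E (x - y))"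

definition sub_nspace :: "'a nspace \<Rightarrow> 'a set \<Rightarrow> 'a nspace" where
  "sub_nspace E M = NSpace M (nrm E)"

definition finite_dim_subspace :: "'a::real_vector set \<Rightarrow> 'a nspace \<Rightarrow> bool" where
  "finite_dim_subspace M E \<longleftrightarrow> subspace M \<and> M \<subseteq> carr E \<and> (\<exists>B. finite B \<and> M = span B)"

definition real_line :: "real nspace" where
  "real_line = NSpace UNIV abs"

definition linear_on :: "'a::real_vector set \<Rightarrow> ('a \<Rightarrow> 'b::real_vector) \<Rightarrow> bool" where
  "linear_on V f \<longleftrightarrow> (\<forall>x\<in>V. \<forall>y\<in>V. f (x + y) = f x + f y) \<and> (\<forall>c. \<forall>x\<in>V. f (c *\<^sub>R x) = c *\<^sub>R f x)"

definition unit_ball :: "'a nspace \<Rightarrow> 'a set" where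
  "unit_ball E = {x \<in> carr E. nrm E x \<le> 1}"

text \<open>Operator norms are extended reals, so that unbounded maps have norm \<open>\<infinity>\<close>.\<close>

definition op_norm :: "'a nspace \<Rightarrow> 'b nspace \<Rightarrow> ('a \<Rightarrow> 'b) \<Rightarrow> ereal" where
  "op_norm E G T = (SUP x\<in>unit_ball E. ereal (nrm G (T x)))"

definition bounded_operator :: "'a::real_vector nspace \<Rightarrow> 'b::real_vector nspace \<Rightarrow> ('a \<Rightarrow> 'b) \<Rightarrow> bool" where
  "bounded_operator E G T \<longleftrightarrow> T ` carr E \<subseteq> carr G \<and> linear_on (carr E) T \<and> op_norm E G T < \<infinity>"

definition in_dual :: "'a::real_vector nspace \<Rightarrow> ('a \<Rightarrow> real) \<Rightarrow> bool" where
  "in_dual E f \<longleftrightarrow> bounded_operator E real_line f"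

definition dual_norm :: "'a nspace \<Rightarrow> ('a \<Rightarrow> real) \<Rightarrow> ereal" where
  "dual_norm E f = op_norm E real_line f"

text \<open>
  Bounded operators \<open>T\<close> from \<open>E\<close> to the dual of \<open>F\<close>. Elements of the dual are represented by functions
  on the whole type, but only their values on \<open>carr F\<close> count; linearity of \<open>T\<close> is therefore required
  pointwise on \<open>carr F\<close>.
\<close>

definition operator_into_dual ::
    "'a::real_vector nspace \<Rightarrow> 'b::real_vector nspace \<Rightarrow> ('a \<Rightarrow> 'b \<Rightarrow> real) \<Rightarrow> bool" where
  "operator_into_dual E F T \<longleftrightarrow> (\<forall>e\<in>carr E. in_dual F (T e))
     \<and> (\<forall>f\<in>carr F. linear_on (carr E) (\<lambda>e. T e f))
     \<and> (SUP e\<in>unit_ball E. dual_norm F (T e)) < \<infinity>"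


section \<open>The algebraic tensor product\<close>

text \<open>
  A tensor is a finite sum of elementary tensors, where \<open>x \<otimes>\<^sub>t y\<close> is realised as evaluation of bilinear
  forms at \<open>(x, y)\<close>. Over a field bilinear forms separate the points of the algebraic tensor product,
  so this is the algebraic tensor product; the universal property is proved below
  (\<open>linearization_props\<close>).
\<close>

definition eval_pairs :: "('a::real_vector \<times> 'b::real_vector) list \<Rightarrow> ('a \<Rightarrow> 'b \<Rightarrow> real) \<Rightarrow> real" where
  "eval_pairs ps B = (if bilinear B then (\<Sum>(x, y)\<leftarrow>ps. B x y) else 0)"

typedef (overloaded) ('a, 'b) tensor =
    "range (eval_pairs :: ('a::real_vector \<times> 'b::real_vector) list \<Rightarrow> ('a \<Rightarrow> 'b \<Rightarrow> real) \<Rightarrow> real)"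
  by blast

definition tensor_elem :: "'a::real_vector \<Rightarrow> 'b::real_vector \<Rightarrow> ('a, 'b) tensor"
    (infix "\<otimes>\<^sub>t" 72) where
  "x \<otimes>\<^sub>t y = Abs_tensor (eval_pairs [(x, y)])"

lemma eval_pairs_append: "eval_pairs (ps @ qs) B = eval_pairs ps B + eval_pairs qs B"
  by (simp add: eval_pairs_def)

lemma eval_pairs_scale: "eval_pairs (map (\<lambda>(x, y). (c *\<^sub>R x, y)) ps) B = c * eval_pairs ps B"
  by (induction ps) (auto simp: eval_pairs_def bilinear_lmul algebra_simps split: if_splits)

lemma eval_pairs_Nil: "eval_pairs [] B = 0"
  by (simp add: eval_pairs_def)

lemma tensor_range_add:
  assumes "f \<in> range eval_pairs" "g \<in> range eval_pairs"
  shows "(\<lambda>B. f B + g B) \<in> range eval_pairs"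
proof -
  obtain ps qs where "f = eval_pairs ps" "g = eval_pairs qs" using assms by blast
  then have "(\<lambda>B. f B + g B) = eval_pairs (ps @ qs)" by (simp add: eval_pairs_append fun_eq_iff)
  then show ?thesis by blast
qed

lemma tensor_range_scale:
  assumes "f \<in> range eval_pairs"
  shows "(\<lambda>B. c * f B) \<in> range eval_pairs"
proof -
  obtain ps where "f = eval_pairs ps" using assms by blast
  then have "(\<lambda>B. c * f B) = eval_pairs (map (\<lambda>(x, y). (c *\<^sub>R x, y)) ps)"
    by (simp add: eval_pairs_scale fun_eq_iff)
  then show ?thesis by blast
qed

lemma tensor_range_0: "(\<lambda>B. 0) \<in> range eval_pairs"
  by (metis eval_pairs_Nil ext rangeI)

instantiation tensor :: (real_vector, real_vector) real_vector
begin

definition zero_tensor :: "('a, 'b) tensor" where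
  "0 = Abs_tensor (\<lambda>B. 0)"
definition plus_tensor :: "('a, 'b) tensor \<Rightarrow> ('a, 'b) tensor \<Rightarrow> ('a, 'b) tensor" where
  "s + t = Abs_tensor (\<lambda>B. Rep_tensor s B + Rep_tensor t B)"
definition scaleR_tensor :: "real \<Rightarrow> ('a, 'b) tensor \<Rightarrow> ('a, 'b) tensor" where
  "c *\<^sub>R t = Abs_tensor (\<lambda>B. c * Rep_tensor t B)"
definition uminus_tensor :: "('a, 'b) tensor \<Rightarrow> ('a, 'b) tensor" where
  "- t = (- 1) *\<^sub>R (t :: ('a, 'b) tensor)"
definition minus_tensor :: "('a, 'b) tensor \<Rightarrow> ('a, 'b) tensor \<Rightarrow> ('a, 'b) tensor" where
  "s - t = s + - (t :: ('a, 'b) tensor)"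

lemma Rep_tensor_zero: "Rep_tensor 0 = (\<lambda>B. 0)"
  unfolding zero_tensor_def by (rule Abs_tensor_inverse) (rule tensor_range_0)

lemma Rep_tensor_plus: "Rep_tensor (s + t) = (\<lambda>B. Rep_tensor s B + Rep_tensor t B)"
  unfolding plus_tensor_def
  by (rule Abs_tensor_inverse) (rule tensor_range_add[OF Rep_tensor Rep_tensor])

lemma Rep_tensor_scaleR: "Rep_tensor (c *\<^sub>R t) = (\<lambda>B. c * Rep_tensor t B)"
  unfolding scaleR_tensor_def
  by (rule Abs_tensor_inverse) (rule tensor_range_scale[OF Rep_tensor])

instance
  by standard
    (simp_all add: Rep_tensor_inject[symmetric] minus_tensor_def uminus_tensor_def
      Rep_tensor_zero Rep_tensor_plus Rep_tensor_scaleR fun_eq_iff algebra_simps)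

end

definition tensor_sum :: "('a::real_vector \<times> 'b::real_vector) list \<Rightarrow> ('a, 'b) tensor" where
  "tensor_sum ps = (\<Sum>(x, y)\<leftarrow>ps. x \<otimes>\<^sub>t y)"

text \<open>
  For subspaces \<open>E\<close> and \<open>F\<close> the canonical map from their algebraic tensor product into the tensor
  product of the ambient types is injective; \<open>tensor_space E F\<close> is its range. In particular
  \<open>z \<in> M\<^sub>1 \<otimes> M\<^sub>2\<close> is literally membership.
\<close>

definition tensor_space :: "'a::real_vector set \<Rightarrow> 'b::real_vector set \<Rightarrow> ('a, 'b) tensor set" where
  "tensor_space E F = span {x \<otimes>\<^sub>t y |x y. x \<in> E \<and> y \<in> F}"

definition bilinear_on ::
    "'a::real_vector set \<Rightarrow> 'b::real_vector set \<Rightarrow> ('a \<Rightarrow> 'b \<Rightarrow> 'c::real_vector) \<Rightarrow> bool" where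
  "bilinear_on E F \<phi> \<longleftrightarrow> (\<forall>x\<in>E. linear_on F (\<lambda>y. \<phi> x y)) \<and> (\<forall>y\<in>F. linear_on E (\<lambda>x. \<phi> x y))"

text \<open>The values of the linearization outside \<open>tensor_space E F\<close> are arbitrary and never used.\<close>

definition linearization ::
    "'a::real_vector set \<Rightarrow> 'b::real_vector set \<Rightarrow> ('a \<Rightarrow> 'b \<Rightarrow> 'c::real_vector)
      \<Rightarrow> ('a, 'b) tensor \<Rightarrow> 'c" where
  "linearization E F \<phi> = (SOME L. linear L \<and> (\<forall>x\<in>E. \<forall>y\<in>F. L (x \<otimes>\<^sub>t y) = \<phi> x y))"

lemma Rep_tensor_elem: "Rep_tensor (x \<otimes>\<^sub>t y) = eval_pairs [(x, y)]"
  unfolding tensor_elem_def by (rule Abs_tensor_inverse) blast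

lemma Rep_tensor_sum: "Rep_tensor (tensor_sum ps) = eval_pairs ps"
proof (induction ps)
  case Nil
  then show ?case
    by (simp add: tensor_sum_def Rep_tensor_zero eval_pairs_Nil fun_eq_iff)
next
  case (Cons p ps)
  then show ?case
    by (cases p) (simp add: tensor_sum_def Rep_tensor_plus Rep_tensor_elem eval_pairs_def fun_eq_iff)
qed

lemma tensor_sum_append: "tensor_sum (ps @ qs) = tensor_sum ps + tensor_sum qs"
  by (simp add: tensor_sum_def)

lemma tensor_sum_exists: "\<exists>ps. t = tensor_sum ps"
proof -
  obtain ps where "Rep_tensor t = eval_pairs ps" using Rep_tensor[of t] by blast
  then show ?thesis by (metis Rep_tensor_sum Rep_tensor_inject)
qed

lemma linear_functionals_separate:
  fixes v :: "'c::real_vector"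
  assumes "v \<noteq> 0"
  shows "\<exists>f :: 'c \<Rightarrow> real. linear f \<and> f v \<noteq> 0"
proof -
  have "independent {v}" using assms by simp
  then obtain g :: "'c \<Rightarrow> real" where "linear g" "\<forall>x\<in>{v}. g x = 1"
    using linear_independent_extend[of "{v}" "\<lambda>_. 1 :: real"] by blast
  then show ?thesis by (intro exI[of _ g]) auto
qed

lemma tensor_sum_eqD:
  fixes G :: "'a::real_vector \<Rightarrow> 'b::real_vector \<Rightarrow> 'c::real_vector"
  assumes "bilinear G" and eq: "tensor_sum ps = tensor_sum qs"
  shows "(\<Sum>(x, y)\<leftarrow>ps. G x y) = (\<Sum>(x, y)\<leftarrow>qs. G x y)"
proof (rule ccontr)
  assume "\<not> ?thesis"
  then obtain f :: "'c \<Rightarrow> real" where f: "linear f"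
      and ne: "f ((\<Sum>(x, y)\<leftarrow>ps. G x y) - (\<Sum>(x, y)\<leftarrow>qs. G x y)) \<noteq> 0"
    using linear_functionals_separate[of "(\<Sum>(x, y)\<leftarrow>ps. G x y) - (\<Sum>(x, y)\<leftarrow>qs. G x y)"] by auto
  have bil: "bilinear (\<lambda>x y. f (G x y))"
    using assms(1) by (auto simp: bilinear_def intro!: linear_compose[OF _ f, unfolded comp_def])
  have f_sum: "f (\<Sum>(x, y)\<leftarrow>rs. G x y) = eval_pairs rs (\<lambda>x y. f (G x y))" for rs
    unfolding eval_pairs_def using bil
    by (induction rs) (auto simp: linear_0[OF f] linear_add[OF f])
  have "eval_pairs ps = eval_pairs qs" using eq by (metis Rep_tensor_sum)
  then show False using ne f_sum[of ps] f_sum[of qs] by (simp add: linear_diff[OF f])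
qed

lemma bilinear_factor:
  fixes G :: "'a::real_vector \<Rightarrow> 'b::real_vector \<Rightarrow> 'c::real_vector"
  assumes G: "bilinear G"
  shows "\<exists>L. linear L \<and> (\<forall>x y. L (x \<otimes>\<^sub>t y) = G x y)"
proof -
  define L where "L t = (\<Sum>(x, y)\<leftarrow>(SOME ps. t = tensor_sum ps). G x y)" for t
  have L: "L (tensor_sum ps) = (\<Sum>(x, y)\<leftarrow>ps. G x y)" for ps
    unfolding L_def
    by (rule tensor_sum_eqD[OF G, symmetric]) (rule someI[of "\<lambda>qs. tensor_sum ps = tensor_sum qs" ps], simp)
  have add: "L (s + t) = L s + L t" for s t
  proof -
    obtain ps qs where "s = tensor_sum ps" "t = tensor_sum qs" using tensor_sum_exists by metis
    then show ?thesis using L[of ps] L[of qs] L[of "ps @ qs"] by (simp add: tensor_sum_append)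
  qed
  have scale: "L (c *\<^sub>R t) = c *\<^sub>R L t" for c t
  proof -
    obtain ps where ps: "t = tensor_sum ps" using tensor_sum_exists by metis
    have "c *\<^sub>R t = tensor_sum (map (\<lambda>(x, y). (c *\<^sub>R x, y)) ps)"
      by (simp add: ps Rep_tensor_inject[symmetric] Rep_tensor_scaleR Rep_tensor_sum
          eval_pairs_scale fun_eq_iff)
    moreover have "(\<Sum>(x, y)\<leftarrow>map (\<lambda>(x, y). (c *\<^sub>R x, y)) ps. G x y) = c *\<^sub>R (\<Sum>(x, y)\<leftarrow>ps. G x y)"
      using G by (induction ps) (auto simp: bilinear_lmul scaleR_add_right)
    ultimately show ?thesis using L[of ps] L[of "map (\<lambda>(x, y). (c *\<^sub>R x, y)) ps"] ps by simp
  qed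
  have "L (x \<otimes>\<^sub>t y) = G x y" for x y
    using L[of "[(x, y)]"] by (simp add: tensor_sum_def)
  then show ?thesis using add scale by (intro exI[of _ L]) (simp add: linearI)
qed

lemma bilinear_on_extend:
  assumes E: "subspace E" and F: "subspace F" and \<phi>: "bilinear_on E F \<phi>"
  shows "\<exists>G. bilinear G \<and> (\<forall>x\<in>E. \<forall>y\<in>F. G x y = \<phi> x y)"
proof -
  obtain p where p: "range p \<subseteq> E" "linear p" "\<forall>v\<in>E. p v = v"
    using linear_exists_left_inverse_on[of "\<lambda>x. x" E] E by (auto simp: inj_on_def linear_ident)
  obtain q where q: "range q \<subseteq> F" "linear q" "\<forall>v\<in>F. q v = v"
    using linear_exists_left_inverse_on[of "\<lambda>x. x" F] F by (auto simp: inj_on_def linear_ident)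
  have mem: "p x \<in> E" "q y \<in> F" for x y using p(1) q(1) by auto
  have "bilinear (\<lambda>x y. \<phi> (p x) (q y))"
    unfolding bilinear_def
    using \<phi> mem
    by (auto intro!: linearI simp: bilinear_on_def linear_on_def linear_add[OF p(2)] linear_add[OF q(2)]
        linear_cmul[OF p(2)] linear_cmul[OF q(2)])
  then show ?thesis using p(3) q(3) by (intro exI[of _ "\<lambda>x y. \<phi> (p x) (q y)"]) auto
qed

lemma linearization_props:
  assumes "subspace E" "subspace F" "bilinear_on E F \<phi>"
  shows "linear (linearization E F \<phi>)"
    and "\<And>x y. x \<in> E \<Longrightarrow> y \<in> F \<Longrightarrow> linearization E F \<phi> (x \<otimes>\<^sub>t y) = \<phi> x y"
proof -
  obtain G where "bilinear G" "\<forall>x\<in>E. \<forall>y\<in>F. G x y = \<phi> x y" using bilinear_on_extend[OF assms] by blast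
  moreover from this(1) obtain L where "linear L" "\<forall>x y. L (x \<otimes>\<^sub>t y) = G x y"
    using bilinear_factor by blast
  ultimately have "\<exists>L. linear L \<and> (\<forall>x\<in>E. \<forall>y\<in>F. L (x \<otimes>\<^sub>t y) = \<phi> x y)" by auto
  from someI_ex[OF this] show "linear (linearization E F \<phi>)"
    and "\<And>x y. x \<in> E \<Longrightarrow> y \<in> F \<Longrightarrow> linearization E F \<phi> (x \<otimes>\<^sub>t y) = \<phi> x y"
    unfolding linearization_def by blast+
qed

lemma linearization_unique:
  assumes "subspace E" "subspace F" "bilinear_on E F \<phi>"
    and "linear L" "\<And>x y. x \<in> E \<Longrightarrow> y \<in> F \<Longrightarrow> L (x \<otimes>\<^sub>t y) = \<phi> x y" "z \<in> tensor_space E F"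
  shows "L z = linearization E F \<phi> z"
proof (rule linear_eq_on_span[OF assms(4) linearization_props(1)[OF assms(1-3)]])
  show "z \<in> span {x \<otimes>\<^sub>t y |x y. x \<in> E \<and> y \<in> F}" using assms(6) by (simp add: tensor_space_def)
qed (use assms(5) linearization_props(2)[OF assms(1-3)] in auto)

definition tensor_map ::
    "'a::real_vector set \<Rightarrow> 'b::real_vector set \<Rightarrow> ('a \<Rightarrow> 'c::real_vector) \<Rightarrow> ('b \<Rightarrow> 'd::real_vector)
      \<Rightarrow> ('a, 'b) tensor \<Rightarrow> ('c, 'd) tensor" where
  "tensor_map E F S T = linearization E F (\<lambda>x y. S x \<otimes>\<^sub>t T y)"

definition tensor_flip :: "('a::real_vector, 'b::real_vector) tensor \<Rightarrow> ('b, 'a) tensor" where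
  "tensor_flip = linearization UNIV UNIV (\<lambda>x y. y \<otimes>\<^sub>t x)"


section \<open>Tensor norms\<close>

definition proj_norm ::
    "'a::real_vector nspace \<Rightarrow> 'b::real_vector nspace \<Rightarrow> ('a, 'b) tensor \<Rightarrow> real" where
  "proj_norm E F z = Inf {(\<Sum>(x, y)\<leftarrow>ps. nrm E x * nrm F y) |ps.
     set ps \<subseteq> carr E \<times> carr F \<and> z = tensor_sum ps}"

definition inj_norm ::
    "'a::real_vector nspace \<Rightarrow> 'b::real_vector nspace \<Rightarrow> ('a, 'b) tensor \<Rightarrow> real" where
  "inj_norm E F z = Sup {\<bar>linearization (carr E) (carr F) (\<lambda>x y. f x * g y) z\<bar> |f g.
     in_dual E f \<and> in_dual F g \<and> dual_norm E f \<le> 1 \<and> dual_norm F g \<le> 1}"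

type_synonym 'a assigned_norm = "'a nspace \<Rightarrow> 'a nspace \<Rightarrow> ('a, 'a) tensor \<Rightarrow> real"

definition tensor_nspace :: "'a::real_vector assigned_norm \<Rightarrow> 'a nspace \<Rightarrow> 'a nspace \<Rightarrow> ('a, 'a) tensor nspace" where
  "tensor_nspace \<alpha> E F = NSpace (tensor_space (carr E) (carr F)) (\<alpha> E F)"

definition tensor_norm :: "'a::real_vector assigned_norm \<Rightarrow> bool" where
  "tensor_norm \<alpha> \<longleftrightarrow>
     (\<forall>E F. normed_space E \<longrightarrow> normed_space F \<longrightarrow>
        normed_space (tensor_nspace \<alpha> E F)
        \<and> (\<forall>z\<in>tensor_space (carr E) (carr F). inj_norm E F z \<le> \<alpha> E F z \<and> \<alpha> E F z \<le> proj_norm E F z))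
   \<and> (\<forall>E1 E2 G1 G2 T1 T2.
        normed_space E1 \<longrightarrow> normed_space E2 \<longrightarrow> normed_space G1 \<longrightarrow> normed_space G2 \<longrightarrow>
        bounded_operator E1 G1 T1 \<longrightarrow> bounded_operator E2 G2 T2 \<longrightarrow>
        op_norm (tensor_nspace \<alpha> E1 E2) (tensor_nspace \<alpha> G1 G2) (tensor_map (carr E1) (carr E2) T1 T2)
          \<le> op_norm E1 G1 T1 * op_norm E2 G2 T2)"

definition finitely_generated :: "'a::real_vector assigned_norm \<Rightarrow> bool" where
  "finitely_generated \<alpha> \<longleftrightarrow>
     (\<forall>E1 E2. normed_space E1 \<longrightarrow> normed_space E2 \<longrightarrow>
        (\<forall>z\<in>tensor_space (carr E1) (carr E2).
           \<alpha> E1 E2 z = Inf {\<alpha> (sub_nspace E1 M1) (sub_nspace E2 M2) z |M1 M2.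
             finite_dim_subspace M1 E1 \<and> finite_dim_subspace M2 E2 \<and> z \<in> tensor_space M1 M2}))"

definition transposed_norm :: "'a::real_vector assigned_norm \<Rightarrow> 'a assigned_norm" where
  "transposed_norm \<alpha> E F z = \<alpha> F E (tensor_flip z)"


section \<open>Integral forms and local complementation\<close>

definition integral_norm :: "'a::real_vector assigned_norm \<Rightarrow> 'a nspace \<Rightarrow> 'a nspace \<Rightarrow> ('a \<Rightarrow> 'a \<Rightarrow> real) \<Rightarrow> ereal" where
  "integral_norm \<alpha> E F \<phi> = dual_norm (tensor_nspace \<alpha> E F) (linearization (carr E) (carr F) \<phi>)"

text \<open>\<open>integral_form \<alpha> E F \<phi>\<close>: the bilinear form \<open>\<phi>\<close> on \<open>E \<times> F\<close> is \<open>\<alpha>\<^sup>*\<close>-integral.\<close>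

definition integral_form :: "'a::real_vector assigned_norm \<Rightarrow> 'a nspace \<Rightarrow> 'a nspace \<Rightarrow> ('a \<Rightarrow> 'a \<Rightarrow> real) \<Rightarrow> bool" where
  "integral_form \<alpha> E F \<phi> \<longleftrightarrow> bilinear_on (carr E) (carr F) \<phi>
     \<and> in_dual (tensor_nspace \<alpha> E F) (linearization (carr E) (carr F) \<phi>)"

definition locally_complemented :: "'a::real_vector assigned_norm \<Rightarrow> 'a nspace \<Rightarrow> 'a set \<Rightarrow> bool" where
  "locally_complemented \<alpha> X Y \<longleftrightarrow>
     (\<exists>c::real. \<forall>F. finite_dim_subspace F X \<longrightarrow>
        (\<forall>T. operator_into_dual (sub_nspace X Y) (sub_nspace X F) T \<longrightarrow>
           (\<exists>T'. operator_into_dual X (sub_nspace X F) T'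
               \<and> (\<forall>y\<in>Y. \<forall>f\<in>F. T' y f = T y f)
               \<and> integral_norm \<alpha> X (sub_nspace X F) T'
                   \<le> ereal c * integral_norm \<alpha> (sub_nspace X Y) (sub_nspace X F) T)))"

definition form_extends :: "'a set \<Rightarrow> 'b set \<Rightarrow> ('a \<Rightarrow> 'b \<Rightarrow> real) \<Rightarrow> ('a \<Rightarrow> 'b \<Rightarrow> real) \<Rightarrow> bool" where
  "form_extends E F \<phi> \<psi> \<longleftrightarrow> (\<forall>x\<in>E. \<forall>y\<in>F. \<psi> x y = \<phi> x y)"

text \<open>
  In \<open>locally_complemented \<alpha>\<close> an operator \<open>T\<close> from \<open>Y\<close> to the dual of \<open>F\<close> is a form on \<open>Y \<times> F\<close>, so \<open>Y\<close> is the
  first factor; for \<open>transposed_norm \<alpha>\<close> the same operator is measured as a form on \<open>F \<times> Y\<close>, with \<open>Y\<close>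
  as the second factor. For a symmetric tensor norm the two notions agree.
\<close>

lemma locally_complemented_transposed:
  assumes X: "normed_space X" "subspace Y" "Y \<subseteq> carr X"
    and sym: "\<And>E F z. normed_space E \<Longrightarrow> normed_space F \<Longrightarrow> z \<in> tensor_space (carr E) (carr F) \<Longrightarrow>
      \<alpha> F E (tensor_flip z) = \<alpha> E F z"
  shows "locally_complemented (transposed_norm \<alpha>) X Y \<longleftrightarrow> locally_complemented \<alpha> X Y"
proof -
  have sub: "normed_space (sub_nspace X M)" if "subspace M" "M \<subseteq> carr X" for M
    using X(1) that unfolding normed_space_def sub_nspace_def by (simp add: subset_iff)
  have eq: "integral_norm (transposed_norm \<alpha>) E F \<phi> = integral_norm \<alpha> E F \<phi>"
    if "normed_space E" "normed_space F" for E F \<phi>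
  proof -
    have "unit_ball (tensor_nspace (transposed_norm \<alpha>) E F) = unit_ball (tensor_nspace \<alpha> E F)"
      using sym[OF that] by (auto simp: unit_ball_def tensor_nspace_def transposed_norm_def)
    then show ?thesis by (simp add: integral_norm_def dual_norm_def op_norm_def)
  qed
  have "integral_norm (transposed_norm \<alpha>) X (sub_nspace X F) = integral_norm \<alpha> X (sub_nspace X F)"
      "integral_norm (transposed_norm \<alpha>) (sub_nspace X Y) (sub_nspace X F)
        = integral_norm \<alpha> (sub_nspace X Y) (sub_nspace X F)"
    if "finite_dim_subspace F X" for F
    using that eq sub X by (auto simp: finite_dim_subspace_def)
  then show ?thesis unfolding locally_complemented_def by simp
qed

end

theory Submission
  imports Defs
begin

text \<open>
  The extension problem is a domination problem. Write \<open>Z\<close> for the second factor (\<open>Y\<close> or all of \<open>X\<close>).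
  A form on \<open>Y \<times> Z\<close> is a functional \<open>L\<close> on \<open>Y \<otimes> Z\<close>, which sits inside \<open>X \<otimes> Z\<close>. By the Hahn--Banach
  theorem, \<open>L\<close> extends to an \<open>\<alpha>\<close>-bounded functional on \<open>X \<otimes> Z\<close> as soon as
  \<open>\<bar>L u\<bar> \<le> C * \<alpha> X Z u\<close> for all \<open>u \<in> Y \<otimes> Z\<close>: boundedness has to be checked for the smaller norm that
  \<open>u\<close> inherits from the larger space.

  This inequality (\<open>bounded_in_larger_space\<close>) is where the hypotheses meet. As \<open>\<alpha>\<close> is finitely
  generated, \<open>\<alpha> X Z u\<close> is an infimum of values \<open>\<alpha> M N u\<close> with \<open>M \<subseteq> X\<close> and \<open>N \<subseteq> Z\<close> finite-dimensional
  and \<open>u \<in> M \<otimes> N\<close>. A projection onto \<open>Y\<close> shows that \<open>u\<close> then lies in \<open>Y \<otimes> N\<close>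
  (\<open>tensor_space_factor_intersection\<close>). Local complementation, applied to the restriction of the form
  to \<open>Y \<times> N\<close>, yields a form on \<open>X \<times> N\<close> that takes the same value at \<open>u\<close> and has norm at most \<open>\<bar>c\<bar>\<close>
  times the norm of \<open>L\<close>, hence \<open>\<bar>L u\<bar> \<le> \<bar>c\<bar> * \<parallel>L\<parallel> * \<alpha> X N u \<le> \<bar>c\<bar> * \<parallel>L\<parallel> * \<alpha> M N u\<close>.
  The constant does not depend on \<open>M\<close> and \<open>N\<close>, so the infimum may be taken.

  Extending in the second factor is the same statement for the transposed norm. The argument is
  therefore carried out for monotone cross norms, a class that contains the tensor norms and is
  visibly closed under transposition.
\<close>

section \<open>Hahn--Banach\<close>

text \<open>
  Partial functionals dominated by \<open>p\<close> are represented by their graphs, as subspaces of a product.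
  Since \<open>p 0 = 0\<close>, domination alone makes such a subspace single-valued, so that no separate
  functionality condition has to be maintained. The value \<open>a\<close> at the new vector \<open>v\<close> has to satisfy
  \<open>r - p (x - v) \<le> a \<le> p (x + v) - r\<close> for all \<open>(x, r)\<close> in the graph; subadditivity leaves room for it.
\<close>

lemma dominated_graph_extend_one:
  fixes p :: "'b::real_vector \<Rightarrow> real" and G :: "('b \<times> real) set"
  assumes sub: "\<And>x y. p (x + y) \<le> p x + p y"
    and hom: "\<And>c x. 0 \<le> c \<Longrightarrow> p (c *\<^sub>R x) = c * p x"
    and G: "subspace G" and dom: "\<And>x r. (x, r) \<in> G \<Longrightarrow> r \<le> p x"
  shows "\<exists>H. subspace H \<and> G \<subseteq> H \<and> (\<forall>(x, r)\<in>H. r \<le> p x) \<and> v \<in> fst ` H"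
proof -
  have G0: "(0, 0) \<in> G" using subspace_0[OF G] by (simp add: zero_prod_def)
  have cross: "r - p (x - v) \<le> p (x' + v) - r'" if "(x, r) \<in> G" "(x', r') \<in> G" for x r x' r'
  proof -
    have "(x + x', r + r') \<in> G" using subspace_add[OF G that] by simp
    then have "r + r' \<le> p (x + x')" by (rule dom)
    also have "\<dots> \<le> p (x - v) + p (x' + v)" using sub[of "x - v" "x' + v"] by simp
    finally show ?thesis by simp
  qed
  define a where "a = (SUP (x, r)\<in>G. r - p (x - v))"
  have bdd: "bdd_above ((\<lambda>(x, r). r - p (x - v)) ` G)"
    using cross[OF _ G0] by (auto intro!: bdd_aboveI)
  have lower: "r - p (x - v) \<le> a" if "(x, r) \<in> G" for x r
    unfolding a_def using cSUP_upper[OF that bdd] by simp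
  have upper: "a \<le> p (x + v) - r" if "(x, r) \<in> G" for x r
    unfolding a_def using G0 cross[OF _ that] by (intro cSUP_least) auto
  have bound: "r + t * a \<le> p (x + t *\<^sub>R v)" if xr: "(x, r) \<in> G" for x r t
  proof -
    have scaled: "((1 / s) *\<^sub>R x, r / s) \<in> G" for s :: real
      using subspace_scale[OF G xr, of "1 / s"] by simp
    consider "t = 0" | "t > 0" | "t < 0" by linarith
    then show ?thesis
    proof cases
      case 1
      then show ?thesis using dom[OF xr] by simp
    next
      case 2
      have "t * a \<le> t * (p ((1 / t) *\<^sub>R x + v) - r / t)"
        using upper[OF scaled[of t]] 2 by (intro mult_left_mono) auto
      also have "\<dots> = p (t *\<^sub>R ((1 / t) *\<^sub>R x + v)) - r"
        using hom[of t "(1 / t) *\<^sub>R x + v"] 2 by (simp add: right_diff_distrib)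
      finally show ?thesis using 2 by (simp add: scaleR_add_right)
    next
      case 3
      define s where "s = - t"
      have s: "s > 0" using 3 by (simp add: s_def)
      have "s * (r / s - p ((1 / s) *\<^sub>R x - v)) \<le> s * a"
        using lower[OF scaled[of s]] s by (intro mult_left_mono) auto
      moreover have "s * (r / s - p ((1 / s) *\<^sub>R x - v)) = r - p (s *\<^sub>R ((1 / s) *\<^sub>R x - v))"
        using hom[of s "(1 / s) *\<^sub>R x - v"] s by (simp add: right_diff_distrib)
      ultimately have "r - p (x - s *\<^sub>R v) \<le> s * a" using s by (simp add: scaleR_diff_right)
      then show ?thesis by (simp add: s_def)
    qed
  qed
  let ?H = "span (insert (v, a) G)"
  have "r \<le> p x" if H: "(x, r) \<in> ?H" for x r
  proof -
    obtain t where "(x, r) - t *\<^sub>R (v, a) \<in> span G"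
      using H by (auto simp: span_insert)
    then have "(x - t *\<^sub>R v, r - t * a) \<in> G" using G by (simp add: span_eq_iff[THEN iffD2])
    from bound[OF this, of t] show ?thesis by simp
  qed
  moreover have "v \<in> fst ` ?H" using span_base[of "(v, a)" "insert (v, a) G"] by force
  moreover have "G \<subseteq> ?H" using span_superset[of "insert (v, a) G"] by blast
  ultimately show ?thesis by (intro exI[of _ ?H]) auto
qed

theorem Hahn_Banach_dominated_extension:
  fixes p f :: "'b::real_vector \<Rightarrow> real"
  assumes sub: "\<And>x y. p (x + y) \<le> p x + p y"
    and hom: "\<And>c x. 0 \<le> c \<Longrightarrow> p (c *\<^sub>R x) = c * p x"
    and W: "subspace W" and f: "linear f" and le: "\<And>w. w \<in> W \<Longrightarrow> f w \<le> p w"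
  shows "\<exists>g. linear g \<and> (\<forall>w\<in>W. g w = f w) \<and> (\<forall>x. g x \<le> p x)"
proof -
  define \<A> where "\<A> = {G. subspace G \<and> (\<lambda>w. (w, f w)) ` W \<subseteq> G \<and> (\<forall>(x, r)\<in>G. r \<le> p x)}"
  have "subspace ((\<lambda>w. (w, f w)) ` W)"
    using f by (intro linear_subspace_image[OF _ W]) (auto intro!: linearI simp: linear_add linear_cmul)
  then have "(\<lambda>w. (w, f w)) ` W \<in> \<A>" using le by (auto simp: \<A>_def)
  then have ne: "\<A> \<noteq> {}" by blast
  have chain: "\<Union>\<C> \<in> \<A>" if "\<C> \<noteq> {}" "subset.chain \<A> \<C>" for \<C>
  proof -
    have mem: "G \<in> \<A>" if "G \<in> \<C>" for G using \<open>subset.chain \<A> \<C>\<close> that by (auto simp: subset_chain_def)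
    have "subspace (\<Union>\<C>)"
    proof (rule subspaceI)
      obtain G where "G \<in> \<C>" using \<open>\<C> \<noteq> {}\<close> by blast
      then show "0 \<in> \<Union>\<C>" using mem[of G] subspace_0[of G] by (auto simp: \<A>_def)
    next
      fix x y assume "x \<in> \<Union>\<C>" "y \<in> \<Union>\<C>"
      then obtain A B where AB: "A \<in> \<C>" "x \<in> A" "B \<in> \<C>" "y \<in> B" by blast
      then have "A \<subseteq> B \<or> B \<subseteq> A" using \<open>subset.chain \<A> \<C>\<close> by (auto simp: subset_chain_def)
      then obtain G where "G \<in> \<C>" "x \<in> G" "y \<in> G" using AB by blast
      then show "x + y \<in> \<Union>\<C>" using mem by (auto simp: \<A>_def intro: subspace_add)
    next
      fix c x assume "x \<in> \<Union>\<C>"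
      then show "c *\<^sub>R x \<in> \<Union>\<C>" using mem by (auto simp: \<A>_def intro: subspace_scale)
    qed
    moreover have "(\<lambda>w. (w, f w)) ` W \<subseteq> \<Union>\<C>" using \<open>\<C> \<noteq> {}\<close> mem by (auto simp: \<A>_def)
    moreover have "\<forall>(x, r)\<in>\<Union>\<C>. r \<le> p x" using mem by (auto simp: \<A>_def)
    ultimately show ?thesis by (simp add: \<A>_def)
  qed
  obtain G where G: "G \<in> \<A>" and max: "\<And>H. H \<in> \<A> \<Longrightarrow> G \<subseteq> H \<Longrightarrow> H = G"
    using subset_Zorn_nonempty[OF ne chain] by blast
  have subG: "subspace G" and Wf: "\<And>w. w \<in> W \<Longrightarrow> (w, f w) \<in> G"
    and dom: "\<And>x r. (x, r) \<in> G \<Longrightarrow> r \<le> p x" using G by (auto simp: \<A>_def)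
  have total: "\<exists>r. (x, r) \<in> G" for x
  proof -
    obtain H where H: "subspace H" "G \<subseteq> H" "\<forall>(x, r)\<in>H. r \<le> p x" "x \<in> fst ` H"
      using dominated_graph_extend_one[OF sub hom subG dom] by blast
    then have "H \<in> \<A>" using G by (auto simp: \<A>_def)
    then have "H = G" by (rule max) (rule H(2))
    then show ?thesis using H(4) by auto
  qed
  have p0: "p 0 = 0" using hom[of 0 0] by simp
  have unique: "r = s" if "(x, r) \<in> G" "(x, s) \<in> G" for x r s
  proof -
    have "r - s \<le> p 0" "s - r \<le> p 0"
      using dom subspace_diff[OF subG that] subspace_diff[OF subG that(2,1)] by simp_all
    then show ?thesis using p0 by simp
  qed
  obtain g where g: "(x, g x) \<in> G" for x using total by metis
  have "linear g"
  proof (rule linearI)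
    show "g (x + y) = g x + g y" for x y
      using unique[OF g] subspace_add[OF subG g g] by simp
    show "g (c *\<^sub>R x) = c *\<^sub>R g x" for c x
      using unique[OF g] subspace_scale[OF subG g] by simp
  qed
  then show ?thesis using unique[OF g Wf] dom[OF g] by blast
qed

section \<open>Operator norms\<close>

lemma zero_in_carr: "normed_space E \<Longrightarrow> 0 \<in> carr E"
  by (simp add: normed_space_def subspace_0)

lemma nrm_zero: "normed_space E \<Longrightarrow> nrm E 0 = 0"
  using zero_in_carr[of E] unfolding normed_space_def by blast

text \<open>Homogeneity is only asked of the composite \<open>nrm G \<circ> T\<close>, which holds for functionals and for
  tensor maps alike.\<close>

lemma op_norm_le_imp_bound:
  assumes E: "normed_space E"
    and hom: "\<And>c x. x \<in> carr E \<Longrightarrow> nrm G (T (c *\<^sub>R x)) = \<bar>c\<bar> * nrm G (T x)"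
    and le: "op_norm E G T \<le> ereal K" and x: "x \<in> carr E"
  shows "nrm G (T x) \<le> K * nrm E x"
proof (cases "x = 0")
  case True
  then have "nrm E x = 0" by (simp add: nrm_zero[OF E])
  then show ?thesis using True hom[OF x, of 0] by simp
next
  case False
  then have pos: "nrm E x > 0" using E x by (metis normed_space_def less_eq_real_def)
  let ?y = "(1 / nrm E x) *\<^sub>R x"
  have y: "?y \<in> carr E" using E x by (simp add: normed_space_def subspace_scale)
  have "nrm E ?y = \<bar>1 / nrm E x\<bar> * nrm E x" using E x by (simp only: normed_space_def)
  then have "?y \<in> unit_ball E" using y pos by (simp add: unit_ball_def)
  then have "ereal (nrm G (T ?y)) \<le> ereal K"
    using le unfolding op_norm_def by (meson SUP_upper order_trans)
  then show ?thesis using hom[OF x] pos by (simp add: divide_simps)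
qed

lemma bound_imp_op_norm_le:
  assumes "0 \<le> K" and bound: "\<And>x. x \<in> carr E \<Longrightarrow> nrm G (T x) \<le> K * nrm E x"
  shows "op_norm E G T \<le> ereal K"
  unfolding op_norm_def
proof (rule SUP_least)
  fix x assume "x \<in> unit_ball E"
  then have "nrm G (T x) \<le> K * nrm E x" "K * nrm E x \<le> K * 1"
    using assms(1) bound mult_left_mono[of "nrm E x" 1 K] by (auto simp: unit_ball_def)
  then show "ereal (nrm G (T x)) \<le> ereal K" by simp
qed

lemma dual_norm_le_imp_bound:
  assumes "normed_space E" "linear_on (carr E) f" "dual_norm E f \<le> ereal K" "x \<in> carr E"
  shows "\<bar>f x\<bar> \<le> K * nrm E x"
  using op_norm_le_imp_bound[of E real_line f K x] assms
  by (simp add: dual_norm_def real_line_def linear_on_def abs_mult)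

lemma bound_imp_dual_norm_le:
  assumes "0 \<le> K" "\<And>x. x \<in> carr E \<Longrightarrow> \<bar>f x\<bar> \<le> K * nrm E x"
  shows "dual_norm E f \<le> ereal K"
  using bound_imp_op_norm_le[of K E real_line f] assms by (simp add: dual_norm_def real_line_def)

text \<open>A positive bound can be asked for because any bound may be enlarged; this later permits
  division by it.\<close>

lemma in_dual_iff_bounded:
  assumes E: "normed_space E"
  shows "in_dual E f \<longleftrightarrow> linear_on (carr E) f \<and> (\<exists>K>0. \<forall>x\<in>carr E. \<bar>f x\<bar> \<le> K * nrm E x)"
    (is "_ \<longleftrightarrow> ?lin \<and> ?bd")
proof -
  have "dual_norm E f < \<infinity> \<longleftrightarrow> ?bd" if lin: ?lin
  proof
    assume "dual_norm E f < \<infinity>"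
    then obtain K where "dual_norm E f \<le> ereal K"
      by (cases "dual_norm E f") auto
    moreover have "ereal K \<le> ereal (\<bar>K\<bar> + 1)" by simp
    ultimately have "dual_norm E f \<le> ereal (\<bar>K\<bar> + 1)" by (rule order_trans)
    from dual_norm_le_imp_bound[OF E lin this] show ?bd by (intro exI[of _ "\<bar>K\<bar> + 1"]) simp
  next
    assume ?bd
    then obtain K where "K > 0" "\<forall>x\<in>carr E. \<bar>f x\<bar> \<le> K * nrm E x" by blast
    then have "dual_norm E f \<le> ereal K" by (intro bound_imp_dual_norm_le) auto
    then show "dual_norm E f < \<infinity>" by (rule le_less_trans) simp
  qed
  then show ?thesis by (auto simp: in_dual_def bounded_operator_def dual_norm_def real_line_def)
qed

section \<open>Algebra of tensor spaces\<close>

lemma normed_space_sub: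
  assumes "normed_space E" "subspace M" "M \<subseteq> carr E"
  shows "normed_space (sub_nspace E M)"
  using assms unfolding normed_space_def sub_nspace_def by (simp add: subset_iff)

lemma carr_sub_nspace [simp]: "carr (sub_nspace E M) = M"
  and nrm_sub_nspace [simp]: "nrm (sub_nspace E M) = nrm E"
  by (simp_all add: sub_nspace_def)

lemma sub_nspace_carr: "sub_nspace E (carr E) = E"
  by (cases E) (simp add: sub_nspace_def)

lemma sub_nspace_sub_nspace: "sub_nspace (sub_nspace E M) N = sub_nspace E N"
  by (simp add: sub_nspace_def)

lemma tensor_space_mono:
  "M1 \<subseteq> E1 \<Longrightarrow> M2 \<subseteq> E2 \<Longrightarrow> tensor_space M1 M2 \<subseteq> tensor_space E1 E2"
  unfolding tensor_space_def by (intro span_mono) blast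

lemma subspace_tensor_space: "subspace (tensor_space E F)"
  by (simp add: tensor_space_def)

lemma tensor_elem_in_space: "x \<in> E \<Longrightarrow> y \<in> F \<Longrightarrow> x \<otimes>\<^sub>t y \<in> tensor_space E F"
  unfolding tensor_space_def by (intro span_base) blast

lemma bilinear_tensor_elem: "bilinear (\<otimes>\<^sub>t)"
proof -
  have 1: "(x + y) \<otimes>\<^sub>t z = x \<otimes>\<^sub>t z + y \<otimes>\<^sub>t z" "x \<otimes>\<^sub>t (z + w) = x \<otimes>\<^sub>t z + x \<otimes>\<^sub>t w"
    "(c *\<^sub>R x) \<otimes>\<^sub>t z = c *\<^sub>R (x \<otimes>\<^sub>t z)" "x \<otimes>\<^sub>t (c *\<^sub>R z) = c *\<^sub>R (x \<otimes>\<^sub>t z)"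
    for x y :: 'a and z w :: 'b and c
    by (auto simp: Rep_tensor_inject[symmetric] Rep_tensor_elem Rep_tensor_plus Rep_tensor_scaleR
      eval_pairs_def fun_eq_iff bilinear_ladd bilinear_radd bilinear_lmul bilinear_rmul)
  show ?thesis unfolding bilinear_def by (auto intro!: linearI simp: 1)
qed

lemma bilinear_on_linear_tensor:
  assumes "linear L"
  shows "bilinear_on E F (\<lambda>x y. L (x \<otimes>\<^sub>t y))"
  by (simp add: bilinear_on_def linear_on_def bilinear_ladd[OF bilinear_tensor_elem]
      bilinear_radd[OF bilinear_tensor_elem] bilinear_lmul[OF bilinear_tensor_elem]
      bilinear_rmul[OF bilinear_tensor_elem] linear_add[OF assms] linear_cmul[OF assms])

lemma linear_eq_on_tensor_space:
  assumes "linear L" "linear L'" "\<And>x y. x \<in> E \<Longrightarrow> y \<in> F \<Longrightarrow> L (x \<otimes>\<^sub>t y) = L' (x \<otimes>\<^sub>t y)"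
    and "z \<in> tensor_space E F"
  shows "L z = L' z"
  using linear_eq_on_span[OF assms(1,2), of "{x \<otimes>\<^sub>t y |x y. x \<in> E \<and> y \<in> F}" z] assms(3,4)
  by (auto simp: tensor_space_def)

lemma linear_maps_tensor_space:
  assumes "linear L" "\<And>x y. x \<in> E \<Longrightarrow> y \<in> F \<Longrightarrow> L (x \<otimes>\<^sub>t y) \<in> V" "subspace V"
    and "z \<in> tensor_space E F"
  shows "L z \<in> V"
proof -
  have "L z \<in> L ` span {x \<otimes>\<^sub>t y |x y. x \<in> E \<and> y \<in> F}" using assms(4) by (simp add: tensor_space_def)
  also have "\<dots> = span (L ` {x \<otimes>\<^sub>t y |x y. x \<in> E \<and> y \<in> F})" by (rule linear_span_image[OF assms(1), symmetric])
  also have "\<dots> \<subseteq> V" using assms(2) by (intro span_minimal assms(3)) auto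
  finally show ?thesis .
qed

text \<open>
  If \<open>P\<close> is an algebraic projection onto \<open>Y\<close>, then \<open>P \<otimes> id\<close> fixes \<open>z \<in> Y \<otimes> F\<close> and maps
  \<open>z \<in> E \<otimes> M\<close> into \<open>Y \<otimes> M\<close>. Thus a representation of \<open>z\<close> that leaves \<open>Y\<close> in the first factor still
  locates \<open>z\<close> in the second factor.
\<close>

lemma tensor_space_factor_intersection:
  fixes z :: "('a::real_vector, 'b::real_vector) tensor"
  assumes Y: "subspace Y" and z: "z \<in> tensor_space Y F" "z \<in> tensor_space E M"
  shows "z \<in> tensor_space Y M"
proof -
  obtain P where P: "range P \<subseteq> Y" "linear P" "\<forall>v\<in>Y. P v = v"
    using linear_exists_left_inverse_on[of "\<lambda>x. x" Y] Y by (auto simp: inj_on_def linear_ident)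
  have "bilinear (\<lambda>x (y::'b). P x \<otimes>\<^sub>t y)"
    using bilinear_tensor_elem P(2) unfolding bilinear_def
    by (auto intro: linear_compose[of P, unfolded comp_def])
  then obtain L where L: "linear L" "\<forall>x (y::'b). L (x \<otimes>\<^sub>t y) = P x \<otimes>\<^sub>t y"
    using bilinear_factor by blast
  have "L z = z"
    using linear_eq_on_tensor_space[OF L(1) linear_ident _ z(1)] L(2) P(3) by simp
  moreover have "L z \<in> tensor_space Y M"
    using P(1) L(2) by (intro linear_maps_tensor_space[OF L(1) _ subspace_tensor_space z(2)])
      (auto intro!: tensor_elem_in_space)
  ultimately show ?thesis by simp
qed

text \<open>The infimum in the definition of a finitely generated norm therefore ranges over a nonempty set;
  an infimum over the empty set of reals would carry no information.\<close>

lemma tensor_space_finite_dim: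
  assumes E: "subspace (carr E)" and F: "subspace (carr F)"
    and z: "z \<in> tensor_space (carr E) (carr F)"
  shows "\<exists>M N. finite_dim_subspace M E \<and> finite_dim_subspace N F \<and> z \<in> tensor_space M N"
proof -
  have "\<exists>A B. finite A \<and> finite B \<and> A \<subseteq> carr E \<and> B \<subseteq> carr F \<and> z \<in> tensor_space (span A) (span B)"
    using z unfolding tensor_space_def[of "carr E"]
  proof (induction rule: span_induct_alt)
    case base
    show ?case by (intro exI[of _ "{}"]) (simp add: tensor_space_def span_zero)
  next
    case (step c w u)
    then obtain x y A B where w: "w = x \<otimes>\<^sub>t y" "x \<in> carr E" "y \<in> carr F"
      and AB: "finite A" "finite B" "A \<subseteq> carr E" "B \<subseteq> carr F" "u \<in> tensor_space (span A) (span B)" by blast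
    let ?T = "tensor_space (span (insert x A)) (span (insert y B))"
    have "u \<in> ?T"
      using AB(5) tensor_space_mono[OF span_mono span_mono] by (metis subset_insertI subsetD)
    moreover have "w \<in> ?T" unfolding w by (intro tensor_elem_in_space span_base) auto
    ultimately have "c *\<^sub>R w + u \<in> ?T"
      unfolding tensor_space_def by (intro span_add span_scale)
    then show ?case using AB w by (intro exI[of _ "insert x A"] exI[of _ "insert y B"]) auto
  qed
  then obtain A B where "finite A" "finite B" "A \<subseteq> carr E" "B \<subseteq> carr F"
    "z \<in> tensor_space (span A) (span B)" by blast
  then show ?thesis
    using span_minimal[OF _ E] span_minimal[OF _ F]
    by (intro exI[of _ "span A"] exI[of _ "span B"]) (auto simp: finite_dim_subspace_def)
qed

lemma linear_tensor_flip: "linear (tensor_flip :: ('a::real_vector, 'b::real_vector) tensor \<Rightarrow> _)"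
  and tensor_flip_elem: "tensor_flip ((x::'a) \<otimes>\<^sub>t (y::'b)) = y \<otimes>\<^sub>t x"
proof -
  have "bilinear_on UNIV UNIV (\<lambda>(x::'a) (y::'b). y \<otimes>\<^sub>t x)"
    by (simp add: bilinear_on_def linear_on_def bilinear_ladd[OF bilinear_tensor_elem]
        bilinear_radd[OF bilinear_tensor_elem] bilinear_lmul[OF bilinear_tensor_elem]
        bilinear_rmul[OF bilinear_tensor_elem])
  from linearization_props[OF _ _ this]
  show "linear (tensor_flip :: ('a, 'b) tensor \<Rightarrow> _)" "tensor_flip (x \<otimes>\<^sub>t y) = y \<otimes>\<^sub>t x"
    by (simp_all add: tensor_flip_def)
qed

lemma tensor_flip_in_space: "z \<in> tensor_space E F \<Longrightarrow> tensor_flip z \<in> tensor_space F E"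
  by (rule linear_maps_tensor_space[OF linear_tensor_flip _ subspace_tensor_space])
    (auto simp: tensor_flip_elem tensor_elem_in_space)

lemma tensor_flip_flip: "tensor_flip (tensor_flip z) = z"
proof -
  have "z \<in> tensor_space UNIV UNIV"
  proof -
    obtain ps where "z = tensor_sum ps" using tensor_sum_exists by blast
    moreover have "tensor_sum ps \<in> tensor_space UNIV UNIV"
      by (induction ps) (auto simp: tensor_sum_def subspace_0[OF subspace_tensor_space]
          intro!: subspace_add[OF subspace_tensor_space] tensor_elem_in_space)
    ultimately show ?thesis by simp
  qed
  then show ?thesis
    using linear_eq_on_tensor_space[OF linear_compose[OF linear_tensor_flip linear_tensor_flip] linear_ident]
    by (simp add: tensor_flip_elem)
qed

lemma tensor_flip_in_space_iff: "tensor_flip z \<in> tensor_space F E \<longleftrightarrow> z \<in> tensor_space E F"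
  using tensor_flip_in_space tensor_flip_flip by metis

section \<open>Monotone cross norms\<close>

text \<open>
  These are the properties of a tensor norm that the extension argument rests on: the upper half of the
  comparison with the projective norm, tested on elementary tensors, and the metric mapping property
  for inclusions of subspaces. Both are symmetric in the two factors, so they pass to the transposed
  norm by exchanging \<open>E\<close> and \<open>F\<close>.
\<close>

definition monotone_cross_norm :: "'a::real_vector assigned_norm \<Rightarrow> bool" where
  "monotone_cross_norm \<alpha> \<longleftrightarrow> (\<forall>E F. normed_space E \<longrightarrow> normed_space F \<longrightarrow>
     normed_space (tensor_nspace \<alpha> E F)
   \<and> (\<forall>x\<in>carr E. \<forall>y\<in>carr F. \<alpha> E F (x \<otimes>\<^sub>t y) \<le> nrm E x * nrm F y)
   \<and> (\<forall>M N. subspace M \<longrightarrow> M \<subseteq> carr E \<longrightarrow> subspace N \<longrightarrow> N \<subseteq> carr F \<longrightarrow>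
        (\<forall>z\<in>tensor_space M N. \<alpha> E F z \<le> \<alpha> (sub_nspace E M) (sub_nspace F N) z)))"

lemma monotone_cross_normD:
  assumes "monotone_cross_norm \<alpha>" "normed_space E" "normed_space F"
  shows "normed_space (tensor_nspace \<alpha> E F)"
    and "\<And>x y. x \<in> carr E \<Longrightarrow> y \<in> carr F \<Longrightarrow> \<alpha> E F (x \<otimes>\<^sub>t y) \<le> nrm E x * nrm F y"
    and "\<And>M N z. subspace M \<Longrightarrow> M \<subseteq> carr E \<Longrightarrow> subspace N \<Longrightarrow> N \<subseteq> carr F \<Longrightarrow>
        z \<in> tensor_space M N \<Longrightarrow> \<alpha> E F z \<le> \<alpha> (sub_nspace E M) (sub_nspace F N) z"
  using assms unfolding monotone_cross_norm_def by blast+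

lemma proj_norm_elem_le:
  assumes "normed_space E" "normed_space F" "x \<in> carr E" "y \<in> carr F"
  shows "proj_norm E F (x \<otimes>\<^sub>t y) \<le> nrm E x * nrm F y"
  unfolding proj_norm_def
proof (rule cInf_lower)
  show "nrm E x * nrm F y \<in> {(\<Sum>(x, y)\<leftarrow>ps. nrm E x * nrm F y) |ps.
     set ps \<subseteq> carr E \<times> carr F \<and> x \<otimes>\<^sub>t y = tensor_sum ps}"
    using assms by (auto simp: tensor_sum_def intro!: exI[of _ "[(x, y)]"])
  have "0 \<le> (\<Sum>(x, y)\<leftarrow>ps. nrm E x * nrm F y)" if "set ps \<subseteq> carr E \<times> carr F" for ps
    using that assms(1,2) by (intro sum_list_nonneg) (auto simp: normed_space_def)
  then show "bdd_below {(\<Sum>(x, y)\<leftarrow>ps. nrm E x * nrm F y) |ps.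
     set ps \<subseteq> carr E \<times> carr F \<and> x \<otimes>\<^sub>t y = tensor_sum ps}"
    by (intro bdd_belowI[of _ 0]) auto
qed

lemma inclusion_operator:
  assumes E: "normed_space E" and M: "subspace M" "M \<subseteq> carr E"
  shows "bounded_operator (sub_nspace E M) E (\<lambda>x. x)"
    and "op_norm (sub_nspace E M) E (\<lambda>x. x) \<le> 1"
    and "0 \<le> op_norm (sub_nspace E M) E (\<lambda>x. x)"
proof -
  show le: "op_norm (sub_nspace E M) E (\<lambda>x. x) \<le> 1"
    using bound_imp_op_norm_le[of 1 "sub_nspace E M" E "\<lambda>x. x"] by (simp add: one_ereal_def)
  then have "op_norm (sub_nspace E M) E (\<lambda>x. x) < \<infinity>" by (rule le_less_trans) simp
  then show "bounded_operator (sub_nspace E M) E (\<lambda>x. x)"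
    using M by (auto simp: bounded_operator_def linear_on_def)
  have "0 \<in> unit_ball (sub_nspace E M)"
    using subspace_0[OF M(1)] by (simp add: unit_ball_def nrm_zero[OF E])
  from SUP_upper[OF this, of "\<lambda>x. ereal (nrm E x)"]
  show "0 \<le> op_norm (sub_nspace E M) E (\<lambda>x. x)"
    by (simp add: op_norm_def zero_ereal_def nrm_zero[OF E])
qed

lemma tensor_norm_imp_monotone_cross_norm:
  fixes \<alpha> :: "'a::real_vector assigned_norm"
  assumes \<alpha>: "tensor_norm \<alpha>"
  shows "monotone_cross_norm \<alpha>"
  unfolding monotone_cross_norm_def
proof (intro allI impI conjI ballI)
  fix E F :: "'a nspace" assume E: "normed_space E" and F: "normed_space F"
  show ns: "normed_space (tensor_nspace \<alpha> E F)" using \<alpha> E F by (simp add: tensor_norm_def)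
  show "\<alpha> E F (x \<otimes>\<^sub>t y) \<le> nrm E x * nrm F y" if "x \<in> carr E" "y \<in> carr F" for x y
    using \<alpha> E F tensor_elem_in_space[OF that] proj_norm_elem_le[OF E F that]
    unfolding tensor_norm_def by (meson order_trans)
  fix M N z
  assume M: "subspace M" "M \<subseteq> carr E" and N: "subspace N" "N \<subseteq> carr F" and z: "z \<in> tensor_space M N"
  let ?M = "sub_nspace E M" and ?N = "sub_nspace F N"
  let ?J = "tensor_map (carr ?M) (carr ?N) (\<lambda>x. x) (\<lambda>y. y)"
  have ns': "normed_space ?M" "normed_space ?N" using normed_space_sub E F M N by blast+
  then have nst: "normed_space (tensor_nspace \<alpha> ?M ?N)" using \<alpha> by (simp add: tensor_norm_def)
  \<comment> \<open>The tensor product of the two inclusions is the identity, because tensors over subspaces are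
    tensors over the ambient type; the mapping property for it is monotonicity of the norm.\<close>
  have J: "tensor_map M N (\<lambda>x. x) (\<lambda>y. y) w = w" if "w \<in> tensor_space M N" for w
    using linearization_unique[OF M(1) N(1) bilinear_on_linear_tensor[OF linear_ident] linear_ident _ that]
    by (simp add: tensor_map_def)
  have "op_norm (tensor_nspace \<alpha> ?M ?N) (tensor_nspace \<alpha> E F) ?J
      \<le> op_norm ?M E (\<lambda>x. x) * op_norm ?N F (\<lambda>y. y)"
    using \<alpha> ns' E F inclusion_operator(1)[OF E M] inclusion_operator(1)[OF F N]
    unfolding tensor_norm_def by blast
  also have "\<dots> \<le> 1 * 1"
    using inclusion_operator(2,3)[OF E M] inclusion_operator(2,3)[OF F N]
    by (intro ereal_mult_mono) auto
  finally have le: "op_norm (tensor_nspace \<alpha> ?M ?N) (tensor_nspace \<alpha> E F) ?J \<le> ereal 1"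
    by (simp add: one_ereal_def)
  have "nrm (tensor_nspace \<alpha> E F) (?J z) \<le> 1 * nrm (tensor_nspace \<alpha> ?M ?N) z"
  proof (rule op_norm_le_imp_bound[OF nst _ le])
    fix c w assume "w \<in> carr (tensor_nspace \<alpha> ?M ?N)"
    then have w: "w \<in> tensor_space M N" by (simp add: tensor_nspace_def)
    then have "c *\<^sub>R w \<in> tensor_space M N" by (simp add: tensor_space_def span_scale)
    moreover have "w \<in> tensor_space (carr E) (carr F)" using w tensor_space_mono[OF M(2) N(2)] by blast
    ultimately show "nrm (tensor_nspace \<alpha> E F) (?J (c *\<^sub>R w)) = \<bar>c\<bar> * nrm (tensor_nspace \<alpha> E F) (?J w)"
      using ns w by (simp add: J normed_space_def tensor_nspace_def)
  qed (simp add: tensor_nspace_def z)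
  then show "\<alpha> E F z \<le> \<alpha> ?M ?N z" by (simp add: tensor_nspace_def J[OF z])
qed

lemma monotone_cross_norm_transposed:
  fixes \<alpha> :: "'a::real_vector assigned_norm"
  assumes "monotone_cross_norm \<alpha>"
  shows "monotone_cross_norm (transposed_norm \<alpha>)"
  unfolding monotone_cross_norm_def
proof (intro allI impI conjI ballI)
  fix E F :: "'a nspace" assume E: "normed_space E" and F: "normed_space F"
  note \<alpha> = monotone_cross_normD[OF assms F E]
  show "normed_space (tensor_nspace (transposed_norm \<alpha>) E F)"
  proof -
    have "tensor_flip z = 0 \<longleftrightarrow> z = 0" for z :: "('a, 'a) tensor"
      using linear_0[OF linear_tensor_flip] tensor_flip_flip by metis
    then show ?thesis
      using \<alpha>(1)
      by (auto simp: normed_space_def tensor_nspace_def transposed_norm_def tensor_flip_in_space_iff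
          linear_cmul[OF linear_tensor_flip] linear_add[OF linear_tensor_flip] subspace_tensor_space)
  qed
  show "transposed_norm \<alpha> E F (x \<otimes>\<^sub>t y) \<le> nrm E x * nrm F y" if "x \<in> carr E" "y \<in> carr F" for x y
    using \<alpha>(2)[OF that(2,1)] by (simp add: transposed_norm_def tensor_flip_elem mult.commute)
  show "transposed_norm \<alpha> E F z \<le> transposed_norm \<alpha> (sub_nspace E M) (sub_nspace F N) z"
    if "subspace M" "M \<subseteq> carr E" "subspace N" "N \<subseteq> carr F" "z \<in> tensor_space M N" for M N z
    using \<alpha>(3)[of N M "tensor_flip z"] that tensor_flip_in_space[of z M N] by (simp add: transposed_norm_def)
qed

lemma finitely_generated_transposed:
  fixes \<alpha> :: "'a::real_vector assigned_norm"
  assumes "finitely_generated \<alpha>"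
  shows "finitely_generated (transposed_norm \<alpha>)"
  unfolding finitely_generated_def
proof (intro allI impI ballI)
  fix E F :: "'a nspace" and z
  assume EF: "normed_space E" "normed_space F" "z \<in> tensor_space (carr E) (carr F)"
  have "transposed_norm \<alpha> E F z = Inf {\<alpha> (sub_nspace F N) (sub_nspace E M) (tensor_flip z) |N M.
      finite_dim_subspace N F \<and> finite_dim_subspace M E \<and> tensor_flip z \<in> tensor_space N M}"
    using assms EF tensor_flip_in_space[OF EF(3)]
    unfolding finitely_generated_def transposed_norm_def by blast
  also have "{\<alpha> (sub_nspace F N) (sub_nspace E M) (tensor_flip z) |N M.
      finite_dim_subspace N F \<and> finite_dim_subspace M E \<and> tensor_flip z \<in> tensor_space N M}
    = {transposed_norm \<alpha> (sub_nspace E M) (sub_nspace F N) z |M N.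
      finite_dim_subspace M E \<and> finite_dim_subspace N F \<and> z \<in> tensor_space M N}"
    unfolding transposed_norm_def tensor_flip_in_space_iff by blast
  finally show "transposed_norm \<alpha> E F z = Inf {transposed_norm \<alpha> (sub_nspace E M) (sub_nspace F N) z |M N.
      finite_dim_subspace M E \<and> finite_dim_subspace N F \<and> z \<in> tensor_space M N}" .
qed

section \<open>Integral forms\<close>

text \<open>The linearization is a choice among linear maps that agree on the tensor space. Quantifying over
  all of them turns the construction of an integral form into the construction of a functional.\<close>

lemma integral_form_iff:
  assumes \<alpha>: "monotone_cross_norm \<alpha>" and E: "normed_space E" and F: "normed_space F"
  shows "integral_form \<alpha> E F \<phi> \<longleftrightarrow>
    (\<exists>L. linear L \<and> (\<forall>x\<in>carr E. \<forall>y\<in>carr F. L (x \<otimes>\<^sub>t y) = \<phi> x y)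
      \<and> (\<exists>K>0. \<forall>z\<in>tensor_space (carr E) (carr F). \<bar>L z\<bar> \<le> K * \<alpha> E F z))" (is "_ \<longleftrightarrow> ?R")
proof
  note ns = monotone_cross_normD(1)[OF \<alpha> E F]
  have sp: "subspace (carr E)" "subspace (carr F)" using E F by (auto simp: normed_space_def)
  {
    assume "integral_form \<alpha> E F \<phi>"
    then show ?R
      using linearization_props[OF sp, of \<phi>] in_dual_iff_bounded[OF ns]
      by (intro exI[of _ "linearization (carr E) (carr F) \<phi>"])
        (auto simp: integral_form_def tensor_nspace_def)
  next
    assume ?R
    then obtain L K where L: "linear L" "\<forall>x\<in>carr E. \<forall>y\<in>carr F. L (x \<otimes>\<^sub>t y) = \<phi> x y"
      and K: "K > 0" "\<forall>z\<in>tensor_space (carr E) (carr F). \<bar>L z\<bar> \<le> K * \<alpha> E F z" by blast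
    have bil: "bilinear_on (carr E) (carr F) \<phi>"
      using bilinear_on_linear_tensor[OF L(1), of "carr E" "carr F"] L(2) sp
      by (auto simp: bilinear_on_def linear_on_def subspace_add subspace_scale)
    have "L z = linearization (carr E) (carr F) \<phi> z" if "z \<in> tensor_space (carr E) (carr F)" for z
      using linearization_unique[OF sp bil L(1) _ that] L(2) by blast
    moreover have "linear_on V (linearization (carr E) (carr F) \<phi>)" for V
      using linearization_props(1)[OF sp bil] by (simp add: linear_on_def linear_add linear_cmul)
    ultimately show "integral_form \<alpha> E F \<phi>"
      using K bil in_dual_iff_bounded[OF ns] by (auto simp: integral_form_def tensor_nspace_def)
  }
qed

lemma integral_form_transposed:
  assumes \<alpha>: "monotone_cross_norm \<alpha>" and E: "normed_space E" and F: "normed_space F"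
  shows "integral_form (transposed_norm \<alpha>) F E (\<lambda>y x. \<phi> x y) \<longleftrightarrow> integral_form \<alpha> E F \<phi>"
proof -
  have flip: "linear (L \<circ> tensor_flip)" if "linear L" for L :: "('a, 'a) tensor \<Rightarrow> real"
    by (rule linear_compose[OF linear_tensor_flip that])
  show ?thesis
    unfolding integral_form_iff[OF \<alpha> E F] integral_form_iff[OF monotone_cross_norm_transposed[OF \<alpha>] F E]
      transposed_norm_def
  proof (intro iffI; elim exE conjE)
    fix L :: "('a, 'a) tensor \<Rightarrow> real" and K :: real
    assume "linear L" "\<forall>y\<in>carr F. \<forall>x\<in>carr E. L (y \<otimes>\<^sub>t x) = \<phi> x y"
      and "K > 0" "\<forall>z\<in>tensor_space (carr F) (carr E). \<bar>L z\<bar> \<le> K * \<alpha> E F (tensor_flip z)"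
    then show "\<exists>L. linear L \<and> (\<forall>x\<in>carr E. \<forall>y\<in>carr F. L (x \<otimes>\<^sub>t y) = \<phi> x y)
      \<and> (\<exists>K>0. \<forall>z\<in>tensor_space (carr E) (carr F). \<bar>L z\<bar> \<le> K * \<alpha> E F z)"
      using flip tensor_flip_in_space[of _ "carr E" "carr F"]
      by (intro exI[of _ "L \<circ> tensor_flip"]) (fastforce simp: tensor_flip_elem tensor_flip_flip)
  next
    fix L :: "('a, 'a) tensor \<Rightarrow> real" and K :: real
    assume "linear L" "\<forall>x\<in>carr E. \<forall>y\<in>carr F. L (x \<otimes>\<^sub>t y) = \<phi> x y"
      and "K > 0" "\<forall>z\<in>tensor_space (carr E) (carr F). \<bar>L z\<bar> \<le> K * \<alpha> E F z"
    then show "\<exists>L. linear L \<and> (\<forall>y\<in>carr F. \<forall>x\<in>carr E. L (y \<otimes>\<^sub>t x) = \<phi> x y)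
      \<and> (\<exists>K>0. \<forall>z\<in>tensor_space (carr F) (carr E). \<bar>L z\<bar> \<le> K * \<alpha> E F (tensor_flip z))"
      using flip tensor_flip_in_space[of _ "carr F" "carr E"]
      by (intro exI[of _ "L \<circ> tensor_flip"]) (fastforce simp: tensor_flip_elem)
  qed
qed

text \<open>This is what makes local complementation applicable: integral forms are bounded bilinear forms, as
  the cross norm inequality bounds \<open>\<alpha>\<close> on elementary tensors.\<close>

lemma bounded_form_is_operator:
  assumes E: "normed_space E" and F: "normed_space F" and bil: "bilinear_on (carr E) (carr F) T"
    and K: "0 < K" and bound: "\<And>x y. x \<in> carr E \<Longrightarrow> y \<in> carr F \<Longrightarrow> \<bar>T x y\<bar> \<le> K * (nrm E x * nrm F y)"
  shows "operator_into_dual E F T"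
  unfolding operator_into_dual_def
proof (intro conjI ballI)
  have nn: "nrm E x \<ge> 0" if "x \<in> carr E" for x using E that by (simp add: normed_space_def)
  have nnF: "nrm F x \<ge> 0" if "x \<in> carr F" for x using F that by (simp add: normed_space_def)
  show "linear_on (carr E) (\<lambda>x. T x y)" if "y \<in> carr F" for y using bil that by (simp add: bilinear_on_def)
  show "in_dual F (T x)" if x: "x \<in> carr E" for x
  proof -
    have "\<bar>T x y\<bar> \<le> (K * nrm E x + 1) * nrm F y" if "y \<in> carr F" for y
      using bound[OF x that] nnF[OF that] by (simp add: algebra_simps)
    moreover have "K * nrm E x + 1 > 0" using K nn[OF x] by (simp add: add_nonneg_pos)
    ultimately show ?thesis
      using in_dual_iff_bounded[OF F] bil x unfolding bilinear_on_def by blast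
  qed
  have "(SUP x\<in>unit_ball E. dual_norm F (T x)) \<le> ereal K"
  proof (rule SUP_least)
    fix x assume "x \<in> unit_ball E"
    then have x: "x \<in> carr E" "nrm E x \<le> 1" by (auto simp: unit_ball_def)
    show "dual_norm F (T x) \<le> ereal K"
    proof (rule bound_imp_dual_norm_le)
      fix y assume y: "y \<in> carr F"
      have "\<bar>T x y\<bar> \<le> K * (nrm E x * nrm F y)" by (rule bound[OF x(1) y])
      also have "\<dots> \<le> K * (1 * nrm F y)"
        using K x(2) nnF[OF y] by (intro mult_left_mono mult_right_mono) auto
      finally show "\<bar>T x y\<bar> \<le> K * nrm F y" by simp
    qed (use K in simp)
  qed
  then show "(SUP x\<in>unit_ball E. dual_norm F (T x)) < \<infinity>" by (rule le_less_trans) simp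
qed

lemma operator_into_dual_bilinear:
  assumes "operator_into_dual E F T"
  shows "bilinear_on (carr E) (carr F) T"
  using assms by (simp add: operator_into_dual_def bilinear_on_def in_dual_def bounded_operator_def)

section \<open>Extending integral forms\<close>

text \<open>
  The hypothesis on \<open>L\<close> uses the norm of \<open>Y \<otimes> Z\<close>; the conclusion uses that of \<open>X \<otimes> Z\<close>, which may be
  much smaller on \<open>Y \<otimes> Z\<close>. Only the value of \<open>L\<close> at the given tensor matters, and it is computed
  through a local extension that depends on this tensor.
\<close>

lemma bounded_in_larger_space:
  assumes \<alpha>: "monotone_cross_norm \<alpha>" and fg: "finitely_generated \<alpha>"
    and X: "normed_space X" and Y: "subspace Y" "Y \<subseteq> carr X" and Z: "subspace Z" "Z \<subseteq> carr X"
    and lc: "locally_complemented \<alpha> X Y"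
    and L: "linear L"
    and K: "0 < K" "\<And>z. z \<in> tensor_space Y Z \<Longrightarrow> \<bar>L z\<bar> \<le> K * \<alpha> (sub_nspace X Y) (sub_nspace X Z) z"
  shows "\<exists>C>0. \<forall>u\<in>tensor_space Y Z. \<bar>L u\<bar> \<le> C * \<alpha> X (sub_nspace X Z) u"
proof -
  let ?Y = "sub_nspace X Y" and ?Z = "sub_nspace X Z"
  define \<phi> where "\<phi> x y = L (x \<otimes>\<^sub>t y)" for x y
  have bil: "bilinear_on A B \<phi>" for A B unfolding \<phi>_def by (rule bilinear_on_linear_tensor[OF L])
  have nsY: "normed_space ?Y" and nsZ: "normed_space ?Z" using normed_space_sub X Y Z by blast+
  have spX: "subspace (carr X)" using X by (simp add: normed_space_def)
  obtain c where lc: "\<And>F T. finite_dim_subspace F X \<Longrightarrow> operator_into_dual ?Y (sub_nspace X F) T \<Longrightarrow>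
      \<exists>T'. operator_into_dual X (sub_nspace X F) T' \<and> (\<forall>y\<in>Y. \<forall>f\<in>F. T' y f = T y f)
        \<and> integral_norm \<alpha> X (sub_nspace X F) T' \<le> ereal c * integral_norm \<alpha> ?Y (sub_nspace X F) T"
    using lc unfolding locally_complemented_def by blast
  \<comment> \<open>The constant \<open>c\<close> may be zero or negative; \<open>\<bar>c\<bar> + 1\<close> keeps \<open>C\<close> positive.\<close>
  define C where "C = (\<bar>c\<bar> + 1) * K"
  have C: "C > 0" using K by (simp add: C_def)
  have local: "\<bar>L u\<bar> \<le> C * \<alpha> (sub_nspace X M) (sub_nspace ?Z N) u"
    if u: "u \<in> tensor_space Y Z" and M: "finite_dim_subspace M X" and N: "finite_dim_subspace N ?Z"
      and uMN: "u \<in> tensor_space M N" for u M N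
  proof -
    let ?N = "sub_nspace X N"
    have spM: "subspace M" "M \<subseteq> carr X" using M by (auto simp: finite_dim_subspace_def)
    have spN: "subspace N" "N \<subseteq> Z" "finite_dim_subspace N X"
      using N Z by (auto simp: finite_dim_subspace_def)
    have NX: "N \<subseteq> carr X" using spN Z by blast
    have nsN: "normed_space ?N" using normed_space_sub[OF X spN(1) NX] .
    have uYN: "u \<in> tensor_space Y N" by (rule tensor_space_factor_intersection[OF Y(1) u uMN])
    have boundYN: "\<bar>L w\<bar> \<le> K * \<alpha> ?Y ?N w" if w: "w \<in> tensor_space Y N" for w
    proof -
      have "\<alpha> ?Y ?Z w \<le> \<alpha> (sub_nspace ?Y Y) (sub_nspace ?Z N) w"
        using monotone_cross_normD(3)[OF \<alpha> nsY nsZ, of Y N w] Y(1) spN w by simp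
      then have "K * \<alpha> ?Y ?Z w \<le> K * \<alpha> ?Y ?N w"
        using K(1) by (simp add: sub_nspace_sub_nspace)
      moreover have "w \<in> tensor_space Y Z" using w tensor_space_mono[OF order_refl spN(2)] by blast
      ultimately show ?thesis using K(2)[of w] by linarith
    qed
    have "operator_into_dual ?Y ?N \<phi>"
    proof (rule bounded_form_is_operator[OF nsY nsN bil K(1)])
      fix x y assume "x \<in> carr ?Y" "y \<in> carr ?N"
      then have "\<bar>\<phi> x y\<bar> \<le> K * \<alpha> ?Y ?N (x \<otimes>\<^sub>t y)" "\<alpha> ?Y ?N (x \<otimes>\<^sub>t y) \<le> nrm ?Y x * nrm ?N y"
        using boundYN monotone_cross_normD(2)[OF \<alpha> nsY nsN] tensor_elem_in_space[of x Y y N]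
        by (auto simp: \<phi>_def)
      then show "\<bar>\<phi> x y\<bar> \<le> K * (nrm ?Y x * nrm ?N y)"
        using K(1) by (meson mult_left_mono order_trans less_imp_le)
    qed
    from lc[OF spN(3) this] obtain T where T: "operator_into_dual X ?N T"
      "\<forall>y\<in>Y. \<forall>f\<in>N. T y f = \<phi> y f"
      "integral_norm \<alpha> X ?N T \<le> ereal c * integral_norm \<alpha> ?Y ?N \<phi>" by blast
    let ?T = "linearization (carr X) N T"
    have bilT: "bilinear_on (carr X) N T" using operator_into_dual_bilinear[OF T(1)] by simp
    note lT = linearization_props[OF spX spN(1) bilT]
    have "integral_norm \<alpha> ?Y ?N \<phi> \<le> ereal K"
      unfolding integral_norm_def
    proof (rule bound_imp_dual_norm_le)
      fix w assume "w \<in> carr (tensor_nspace \<alpha> ?Y ?N)"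
      then have w: "w \<in> tensor_space Y N" by (simp add: tensor_nspace_def)
      have "L w = linearization Y N \<phi> w"
        by (rule linearization_unique[OF Y(1) spN(1) bil L _ w]) (simp add: \<phi>_def)
      then show "\<bar>linearization (carr ?Y) (carr ?N) \<phi> w\<bar> \<le> K * nrm (tensor_nspace \<alpha> ?Y ?N) w"
        using boundYN[OF w] by (simp add: tensor_nspace_def)
    qed (use K in simp)
    moreover have "0 \<le> integral_norm \<alpha> ?Y ?N \<phi>"
    proof -
      have "0 \<in> unit_ball (tensor_nspace \<alpha> ?Y ?N)"
        using monotone_cross_normD(1)[OF \<alpha> nsY nsN]
        by (simp add: unit_ball_def zero_in_carr nrm_zero)
      then show ?thesis
        unfolding integral_norm_def dual_norm_def op_norm_def
        by (rule SUP_upper2) (simp add: real_line_def)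
    qed
    ultimately obtain k where k: "integral_norm \<alpha> ?Y ?N \<phi> = ereal k" "0 \<le> k" "k \<le> K"
      by (cases "integral_norm \<alpha> ?Y ?N \<phi>") auto
    have "c * k \<le> (\<bar>c\<bar> + 1) * K" using k by (intro mult_mono) auto
    then have "dual_norm (tensor_nspace \<alpha> X ?N) ?T \<le> ereal C"
      using T(3) k(1) by (simp add: integral_norm_def C_def) (meson ereal_less_eq(3) order_trans)
    then have "\<bar>?T u\<bar> \<le> C * nrm (tensor_nspace \<alpha> X ?N) u"
      using dual_norm_le_imp_bound[OF monotone_cross_normD(1)[OF \<alpha> X nsN], of ?T C u]
        lT(1) uYN tensor_space_mono[OF Y(2) order_refl]
      by (auto simp: tensor_nspace_def linear_on_def linear_add linear_cmul)
    moreover have "?T u = L u"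
    proof (rule linear_eq_on_tensor_space[OF lT(1) L _ uYN])
      show "?T (x \<otimes>\<^sub>t y) = L (x \<otimes>\<^sub>t y)" if "x \<in> Y" "y \<in> N" for x y
        using lT(2)[of x y] T(2) Y(2) that by (auto simp: \<phi>_def)
    qed
    moreover have "\<alpha> X ?N u \<le> \<alpha> (sub_nspace X M) ?N u"
      using monotone_cross_normD(3)[OF \<alpha> X nsN, of M N u] spM spN uMN by (simp add: sub_nspace_sub_nspace)
    then have "C * \<alpha> X ?N u \<le> C * \<alpha> (sub_nspace X M) ?N u" using C by simp
    ultimately show ?thesis by (simp add: tensor_nspace_def sub_nspace_sub_nspace)
  qed
  have "\<bar>L u\<bar> \<le> C * \<alpha> X ?Z u" if u: "u \<in> tensor_space Y Z" for u
  proof -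
    let ?S = "{\<alpha> (sub_nspace X M) (sub_nspace ?Z N) u |M N.
      finite_dim_subspace M X \<and> finite_dim_subspace N ?Z \<and> u \<in> tensor_space M N}"
    have uXZ: "u \<in> tensor_space (carr X) (carr ?Z)"
      using u tensor_space_mono[OF Y(2) order_refl] by auto
    have "?S \<noteq> {}" using tensor_space_finite_dim[OF spX _ uXZ] Z(1) by auto
    moreover have "\<bar>L u\<bar> / C \<le> s" if "s \<in> ?S" for s
      using that local[OF u] C by (auto simp: pos_divide_le_eq mult.commute)
    ultimately have "\<bar>L u\<bar> / C \<le> Inf ?S" by (rule cInf_greatest)
    also have "Inf ?S = \<alpha> X ?Z u"
      using fg[unfolded finitely_generated_def, rule_format, OF X nsZ uXZ] by simp
    finally show ?thesis using C by (simp add: pos_divide_le_eq mult.commute)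
  qed
  then show ?thesis using C by blast
qed

text \<open>Outside its carrier the norm means nothing, so a projection onto the carrier is used to obtain a
  sublinear functional on the whole type.\<close>

lemma Hahn_Banach_normed_subspace:
  fixes f :: "'b::real_vector \<Rightarrow> real"
  assumes E: "normed_space E" and W: "subspace W" "W \<subseteq> carr E" and f: "linear f"
    and C: "0 \<le> C" and bound: "\<And>w. w \<in> W \<Longrightarrow> \<bar>f w\<bar> \<le> C * nrm E w"
  shows "\<exists>g. linear g \<and> (\<forall>w\<in>W. g w = f w) \<and> (\<forall>x\<in>carr E. \<bar>g x\<bar> \<le> C * nrm E x)"
proof -
  have spE: "subspace (carr E)" using E by (simp add: normed_space_def)
  obtain P where P: "range P \<subseteq> carr E" "linear P" "\<forall>v\<in>carr E. P v = v"
    using linear_exists_left_inverse_on[of "\<lambda>x. x" "carr E"] spE by (auto simp: inj_on_def linear_ident)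
  have Pin: "P x \<in> carr E" for x using P(1) by blast
  define p where "p x = C * nrm E (P x)" for x
  have "p (x + y) \<le> p x + p y" for x y
  proof -
    have "nrm E (P x + P y) \<le> nrm E (P x) + nrm E (P y)" using E Pin by (simp add: normed_space_def)
    then show ?thesis using C by (simp add: p_def linear_add[OF P(2)] mult_left_mono flip: distrib_left)
  qed
  moreover have pscale: "p (c *\<^sub>R x) = \<bar>c\<bar> * p x" for c x
    using E Pin by (simp add: p_def linear_cmul[OF P(2)] normed_space_def)
  moreover have "f w \<le> p w" if "w \<in> W" for w
    using bound[OF that] W(2) P(3) that by (auto simp: p_def)
  ultimately obtain g where g: "linear g" "\<forall>w\<in>W. g w = f w" "\<forall>x. g x \<le> p x"
    using Hahn_Banach_dominated_extension[OF _ _ W(1) f, of p] by auto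
  have "\<bar>g x\<bar> \<le> p x" for x
    using g(3)[rule_format, of x] g(3)[rule_format, of "- x"] pscale[of "-1" x]
    by (simp add: linear_neg[OF g(1)])
  then have "\<bar>g x\<bar> \<le> C * nrm E x" if "x \<in> carr E" for x
    using P(3) that unfolding p_def by metis
  then show ?thesis using g(1,2) by blast
qed

lemma integral_form_extends_first_factor:
  assumes \<alpha>: "monotone_cross_norm \<alpha>" and fg: "finitely_generated \<alpha>"
    and X: "normed_space X" and Y: "subspace Y" "Y \<subseteq> carr X" and Z: "subspace Z" "Z \<subseteq> carr X"
    and lc: "locally_complemented \<alpha> X Y"
    and \<phi>: "integral_form \<alpha> (sub_nspace X Y) (sub_nspace X Z) \<phi>"
  shows "\<exists>\<psi>. integral_form \<alpha> X (sub_nspace X Z) \<psi> \<and> form_extends Y Z \<phi> \<psi>"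
proof -
  have nsY: "normed_space (sub_nspace X Y)" and nsZ: "normed_space (sub_nspace X Z)"
    using normed_space_sub X Y Z by blast+
  obtain L K where L: "linear L" "\<forall>x\<in>Y. \<forall>y\<in>Z. L (x \<otimes>\<^sub>t y) = \<phi> x y"
    and K: "K > 0" "\<forall>z\<in>tensor_space Y Z. \<bar>L z\<bar> \<le> K * \<alpha> (sub_nspace X Y) (sub_nspace X Z) z"
    using \<phi> unfolding integral_form_iff[OF \<alpha> nsY nsZ] by auto
  obtain C where C: "C > 0" "\<forall>u\<in>tensor_space Y Z. \<bar>L u\<bar> \<le> C * \<alpha> X (sub_nspace X Z) u"
    using bounded_in_larger_space[OF \<alpha> fg X Y Z lc L(1) K(1)] K(2) by blast
  obtain g where g: "linear g" "\<forall>u\<in>tensor_space Y Z. g u = L u"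
    "\<forall>u\<in>tensor_space (carr X) Z. \<bar>g u\<bar> \<le> C * \<alpha> X (sub_nspace X Z) u"
    using Hahn_Banach_normed_subspace[OF monotone_cross_normD(1)[OF \<alpha> X nsZ],
        of "tensor_space Y Z" L C] C L(1) tensor_space_mono[OF Y(2) order_refl, of Z]
    by (auto simp: tensor_nspace_def tensor_space_def)
  have "integral_form \<alpha> X (sub_nspace X Z) (\<lambda>x y. g (x \<otimes>\<^sub>t y))"
    unfolding integral_form_iff[OF \<alpha> X nsZ] using g C(1) by auto
  moreover have "form_extends Y Z \<phi> (\<lambda>x y. g (x \<otimes>\<^sub>t y))"
    using g(2) L(2) by (simp add: form_extends_def tensor_elem_in_space)
  ultimately show ?thesis by blast
qed

theorem theorem7:
  fixes \<alpha> :: "'a::real_vector assigned_norm" and X :: "'a nspace" and Y :: "'a set"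
  assumes "tensor_norm \<alpha>" and "finitely_generated \<alpha>"
    and "banach_space X" and "subspace Y" and "Y \<subseteq> carr X"
    and "locally_complemented \<alpha> X Y"
  shows "(\<forall>\<phi>. integral_form \<alpha> (sub_nspace X Y) (sub_nspace X Y) \<phi> \<longrightarrow>
            (\<exists>\<psi>. integral_form \<alpha> X (sub_nspace X Y) \<psi> \<and> form_extends Y Y \<phi> \<psi>))
       \<and> (locally_complemented (transposed_norm \<alpha>) X Y \<longrightarrow>
            (\<forall>\<phi>. integral_form \<alpha> (sub_nspace X Y) (sub_nspace X Y) \<phi> \<longrightarrow>
              (\<exists>\<psi>. integral_form \<alpha> (sub_nspace X Y) X \<psi> \<and> form_extends Y Y \<phi> \<psi>)))
       \<and> (\<forall>\<phi>. integral_form \<alpha> (sub_nspace X Y) X \<phi> \<longrightarrow>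
            (\<exists>\<psi>. integral_form \<alpha> X X \<psi> \<and> form_extends Y (carr X) \<phi> \<psi>))"
proof -
  have X: "normed_space X" using assms(3) by (simp add: banach_space_def)
  then have spX: "subspace (carr X)" by (simp add: normed_space_def)
  have nsY: "normed_space (sub_nspace X Y)" using normed_space_sub[OF X assms(4,5)] .
  have \<alpha>: "monotone_cross_norm \<alpha>" by (rule tensor_norm_imp_monotone_cross_norm[OF assms(1)])
  note extend = integral_form_extends_first_factor[OF \<alpha> assms(2) X assms(4,5)]
  \<comment> \<open>Extending the second argument of a form is extending the first argument of its transpose.\<close>
  have second: "\<exists>\<psi>. integral_form \<alpha> (sub_nspace X Y) X \<psi> \<and> form_extends Y Y \<phi> \<psi>"
    if lc: "locally_complemented (transposed_norm \<alpha>) X Y"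
      and \<phi>: "integral_form \<alpha> (sub_nspace X Y) (sub_nspace X Y) \<phi>" for \<phi>
  proof -
    have "integral_form (transposed_norm \<alpha>) (sub_nspace X Y) (sub_nspace X Y) (\<lambda>y x. \<phi> x y)"
      using \<phi> integral_form_transposed[OF \<alpha> nsY nsY] by blast
    then obtain \<psi> where \<psi>: "integral_form (transposed_norm \<alpha>) X (sub_nspace X Y) \<psi>"
      "form_extends Y Y (\<lambda>y x. \<phi> x y) \<psi>"
      using integral_form_extends_first_factor[OF monotone_cross_norm_transposed[OF \<alpha>]
          finitely_generated_transposed[OF assms(2)] X assms(4,5) assms(4,5) lc] by blast
    have "integral_form \<alpha> (sub_nspace X Y) X (\<lambda>y x. \<psi> x y)"
      using \<psi>(1) integral_form_transposed[OF \<alpha> nsY X, of "\<lambda>y x. \<psi> x y"] by simp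
    moreover have "form_extends Y Y \<phi> (\<lambda>y x. \<psi> x y)" using \<psi>(2) by (simp add: form_extends_def)
    ultimately show ?thesis by blast
  qed
  show ?thesis
    using extend[OF assms(4,5,6)] second extend[OF spX order_refl assms(6)]
    by (simp add: sub_nspace_carr)
qed

end
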